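(* Let $F=G/H^p$ with singular variety $\mathcal{V}=\{x\in\mathcal{D}:H(x)=0\}$ and, for a smooth point $c\in\mathcal{V}$ with $c_d\,\partial_dH(c)\neq0$, let $W$, $h$ and $u_j$ ($0\le j<p$) be as in the context. Then for all $0\le j<p$ and $w\in W$, $$u_j(w)=(-h(w))^{-p+j}\lim_{y\to h(w)}\frac{\partial^j}{\partial y^j}\frac{G(w,y)}{Q(w,y)^p},$$ where $Q:((W\times\mathbb{C})\cap\mathcal{D})\setminus\mathcal{V}\to\mathbb{C}$ is given by $Q(w,y)=\frac{H(w,y)}{y-h(w)}$. Moreover, $$\lim_{y\to h(w)}\partial_d^jQ(w,y)=\frac{1}{j+1}\,\partial_d^{j+1}H(w,h(w)).$$ In particular, $$u_0(w)=\frac{G(w,h(w))}{\big(-h(w)\,\partial_dH(w,h(w))\big)^p}.$$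
   Context: Setting. $d,p$ are positive integers; $\mathcal{D}\subseteq\mathbb{C}^d$ is a nonempty open connected set; $G,H:\mathcal{D}\to\mathbb{C}$ are holomorphic and relatively prime in the ring of holomorphic functions on $\mathcal{D}$; $\mathcal{V}=\{x\in\mathcal{D}:H(x)=0\}$ is nonempty and $0\in\mathcal{D}\setminus\mathcal{V}$; $F=G/H^p$ on $\mathcal{D}\setminus\mathcal{V}$. For $x\in\mathbb{C}^d$, $\widehat x=(x_1,\dots,x_{d-1})$. $\partial_d$ is the partial derivative with respect to the last coordinate. A point $c\in\mathcal{V}$ is smooth if $(\partial_1H(x),\dots,\partial_dH(x))\ne0$ for all $x$ in a neighbourhood of $c$. For $c$ smooth with $c_d\partial_dH(c)\ne0$, the implicit function theorem gives a bounded neighbourhood $W$ of $\widehat c$ and a holomorphic $h:W\to\mathbb{C}\setminus\{0\}$ with $h(\widehat c)=c_d$, $(w,h(w))\in\mathcal{V}$ and $\partial_dH(w,h(w))\neq0$ for all $w\in W$. For $0\le j<p$ and $w\in W$, $u_j(w)=\lim_{y\to h(w)}(-y)^{-p+j}\frac{\partial^j}{\partial y^j}\big((y-h(w))^pF(w,y)\big)$. *)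

theory Defs
  imports "HOL-Analysis.Analysis"
begin

type_synonym 'd cvec = "(complex, 'd) vec"

text \<open>
  The space \<open>\<complex>\<^sup>d\<close> is \<^typ>\<open>'d cvec\<close> for an arbitrary finite linearly ordered (hence nonempty)
  index type, with \<open>d = CARD('d)\<close>. Since there is no type of vectors of length \<open>0\<close>, the space
  \<open>\<complex>\<^sup>d\<^sup>-\<^sup>1\<close> is represented by the hyperplane of vectors whose last coordinate is \<open>0\<close>; for
  \<open>d = 1\<close> this is the one-point space.
\<close>

definition last_index :: "'d::{finite,linorder}" where
  "last_index = Max UNIV"

definition hat_space :: "'d::{finite,linorder} cvec set" where
  "hat_space = {w. w $ last_index = 0}"

definition coord_upd :: "'d::finite cvec \<Rightarrow> 'd \<Rightarrow> complex \<Rightarrow> 'd cvec" where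
  "coord_upd x k y = (\<chi> i. if i = k then y else x $ i)"

text \<open>The point \<open>(w, y)\<close> for \<open>w \<in> \<complex>\<^sup>d\<^sup>-\<^sup>1\<close>, and the projection \<open>x \<mapsto> (x\<^sub>1, \<dots>, x\<^sub>d\<^sub>-\<^sub>1)\<close>.\<close>

definition join :: "'d::{finite,linorder} cvec \<Rightarrow> complex \<Rightarrow> 'd cvec" where
  "join w y = coord_upd w last_index y"

definition hat :: "'d::{finite,linorder} cvec \<Rightarrow> 'd cvec" where
  "hat x = coord_upd x last_index 0"

text \<open>
  The derivative is taken within the set, so that the definition applies both to open subsets of
  the whole space and to relatively open subsets of \<^const>\<open>hat_space\<close>. In the latter case only the
  restriction of \<open>f'\<close> to \<^const>\<open>hat_space\<close> is determined, and requiring complex linearity on the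
  whole space is no restriction, as a complex-linear map on the hyperplane extends.
\<close>

definition holomorphic_vec_on :: "('d::finite cvec \<Rightarrow> complex) \<Rightarrow> 'd cvec set \<Rightarrow> bool" where
  "holomorphic_vec_on f S \<longleftrightarrow>
     (\<forall>x\<in>S. \<exists>f'. (f has_derivative f') (at x within S) \<and> (\<forall>a v. f' (a *s v) = a * f' v))"

definition partial_deriv ::
    "'d::finite \<Rightarrow> ('d cvec \<Rightarrow> complex) \<Rightarrow> 'd cvec \<Rightarrow> complex" where
  "partial_deriv k f x = deriv (\<lambda>y. f (coord_upd x k y)) (x $ k)"

text \<open>Divisibility and coprimality in the ring of holomorphic functions on \<open>D\<close>.\<close>

definition hol_dvd ::
    "'d::finite cvec set \<Rightarrow> ('d cvec \<Rightarrow> complex) \<Rightarrow> ('d cvec \<Rightarrow> complex) \<Rightarrow> bool" where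
  "hol_dvd D K G \<longleftrightarrow> (\<exists>A. holomorphic_vec_on A D \<and> (\<forall>x\<in>D. G x = K x * A x))"

definition hol_coprime ::
    "'d::finite cvec set \<Rightarrow> ('d cvec \<Rightarrow> complex) \<Rightarrow> ('d cvec \<Rightarrow> complex) \<Rightarrow> bool" where
  "hol_coprime D G H \<longleftrightarrow>
     (\<forall>K. holomorphic_vec_on K D \<and> hol_dvd D K G \<and> hol_dvd D K H \<longrightarrow> hol_dvd D K (\<lambda>_. 1))"

definition sing_variety ::
    "'d::finite cvec set \<Rightarrow> ('d cvec \<Rightarrow> complex) \<Rightarrow> 'd cvec set" where
  "sing_variety D H = {x \<in> D. H x = 0}"

definition smooth_point ::
    "'d::finite cvec set \<Rightarrow> ('d cvec \<Rightarrow> complex) \<Rightarrow> 'd cvec \<Rightarrow> bool" where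
  "smooth_point D H c \<longleftrightarrow> c \<in> sing_variety D H \<and>
     (\<exists>U. open U \<and> c \<in> U \<and> U \<subseteq> D \<and> (\<forall>x\<in>U. \<exists>k. partial_deriv k H x \<noteq> 0))"

text \<open>
  \<^term>\<open>u_arg p F h j w\<close> is the function of \<open>y\<close> whose limit at \<open>h w\<close> is \<open>u\<^sub>j(w)\<close>. The limit is
  punctured, so the value of \<open>F\<close> on the singular variety plays no role.
\<close>

definition u_arg ::
    "nat \<Rightarrow> ('d::{finite,linorder} cvec \<Rightarrow> complex) \<Rightarrow> ('d cvec \<Rightarrow> complex) \<Rightarrow>
       nat \<Rightarrow> 'd cvec \<Rightarrow> complex \<Rightarrow> complex" where
  "u_arg p F h j w y =
     (- y) powi (- int p + int j) * (deriv ^^ j) (\<lambda>z. (z - h w) ^ p * F (join w z)) y"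

definition u_coeff ::
    "nat \<Rightarrow> ('d::{finite,linorder} cvec \<Rightarrow> complex) \<Rightarrow> ('d cvec \<Rightarrow> complex) \<Rightarrow>
       nat \<Rightarrow> 'd cvec \<Rightarrow> complex" where
  "u_coeff p F h j w = Lim (at (h w)) (u_arg p F h j w)"

end

theory Submission
  imports Defs "HOL-Complex_Analysis.Cauchy_Integral_Formula"
begin

text \<open>
  Fix \<open>w\<close> and restrict everything to the complex line \<open>y \<mapsto> (w, y)\<close>: then \<open>H\<close> becomes a function of
  one variable with a simple zero at \<open>a = h w\<close>, so \<open>H = (y - a) q\<close> with \<open>q\<close> holomorphic and
  nonzero near \<open>a\<close>. Near \<open>a\<close>, away from \<open>a\<close> itself, \<open>Q = q\<close> and \<open>(y - a)\<^sup>p F = G / q\<^sup>p\<close>, so all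
  limits are values at \<open>a\<close> of derivatives of functions that are holomorphic at \<open>a\<close>. Leibniz'
  rule gives \<open>H\<^bsup>(j+1)\<^esup>(a) = (j + 1) q\<^bsup>(j)\<^esup>(a)\<close>.
\<close>

lemma has_derivative_join: "(join w has_derivative (\<lambda>t. t *s axis last_index 1)) F"
proof -
  have eq: "join w = (\<lambda>y. join w 0 + y *s axis last_index 1)"
    by (rule ext) (auto simp: join_def coord_upd_def vec_eq_iff axis_def)
  have "bounded_linear (\<lambda>t::complex. t *s (axis last_index 1 :: 'a cvec))"
    by (intro linear_conv_bounded_linear[THEN iffD1] linearI)
      (auto simp: vec_eq_iff algebra_simps axis_def)
  then show ?thesis
    by (subst eq) (auto intro!: derivative_eq_intros bounded_linear_imp_has_derivative)
qed

lemma open_join_vimage: "open D \<Longrightarrow> open (join w -` D)"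
  using has_derivative_continuous[OF has_derivative_join]
  by (intro open_vimage continuous_at_imp_continuous_on) blast+

text \<open>Chain rule along an affine line: complex linearity of \<open>f'\<close> turns the real
  derivative of the composite into multiplication by the single number
  \<open>f' (axis last_index 1)\<close>.\<close>

lemma holomorphic_on_join:
  assumes "holomorphic_vec_on f D" "open D"
  shows "(\<lambda>y. f (join w y)) holomorphic_on (join w -` D)"
proof (rule holomorphic_onI)
  fix y assume "y \<in> join w -` D"
  then have "join w y \<in> D" by simp
  then obtain f' where f': "(f has_derivative f') (at (join w y))" "\<And>a v. f' (a *s v) = a * f' v"
    using assms unfolding holomorphic_vec_on_def by (metis at_within_open)
  have "((\<lambda>y. f (join w y)) has_derivative (\<lambda>t. t * f' (axis last_index 1))) (at y)"
    using has_derivative_compose[OF has_derivative_join f'(1)] by (simp add: f'(2))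
  then have "((\<lambda>y. f (join w y)) has_field_derivative f' (axis last_index 1)) (at y)"
    by (simp add: has_field_derivative_def mult_commute_abs)
  then show "(\<lambda>y. f (join w y)) field_differentiable (at y within join w -` D)"
    using field_differentiable_at_within field_differentiable_def by blast
qed

text \<open>Differentiation in the last coordinate only sees the line through \<open>w\<close>, so
  iterating it amounts to iterating \<open>deriv\<close> on the restriction to that line. Both sides
  are compared as functions of \<open>y\<close>, which lets the induction apply \<open>deriv\<close>
  once more.\<close>

lemma partial_deriv_funpow_join:
  "(partial_deriv last_index ^^ j) f (join w y) = (deriv ^^ j) (\<lambda>z. f (join w z)) y"
proof -
  have "(\<lambda>y. (partial_deriv last_index ^^ j) f (join w y)) = (deriv ^^ j) (\<lambda>z. f (join w z))"
  proof (induction j)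
    case (Suc j)
    have "coord_upd (join w y) last_index = join w" for y
      by (auto simp: join_def coord_upd_def fun_eq_iff vec_eq_iff)
    moreover have "join w y $ last_index = y" for y
      by (simp add: join_def coord_upd_def)
    ultimately show ?case
      using Suc by (simp add: partial_deriv_def)
  qed simp
  then show ?thesis by metis
qed

text \<open>At each \<open>y\<close> \<noteq> \<open>a\<close> close to \<open>a\<close> the two
  functions agree on a full neighbourhood of \<open>y\<close>, hence so do all their derivatives at
  \<open>y\<close>; the derivatives of \<open>g\<close> are continuous at \<open>a\<close>. The
  value of \<open>f\<close> at \<open>a\<close> is left arbitrary, as it must be for
  \<open>F\<close> and \<open>Q\<close>.\<close>

lemma higher_deriv_tendsto_punctured:
  assumes g: "g holomorphic_on S" and "open S" "a \<in> S"
    and eq: "eventually (\<lambda>z. f z = g z) (at a)"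
  shows "((deriv ^^ j) f \<longlongrightarrow> (deriv ^^ j) g a) (at a)"
proof -
  have "((deriv ^^ j) g \<longlongrightarrow> (deriv ^^ j) g a) (at a)"
    using holomorphic_higher_deriv[OF g] assms
    by (metis holomorphic_on_imp_continuous_on continuous_on_eq_continuous_at isContD)
  moreover have "eventually (\<lambda>y. (deriv ^^ j) g y = (deriv ^^ j) f y) (at a)"
  proof -
    have "eventually (\<lambda>y. eventually (\<lambda>z. f z = g z) (nhds y)) (at a)"
    proof -
      obtain T where "open T" "a \<in> T" and T: "\<And>z. z \<in> T \<Longrightarrow> z \<noteq> a \<Longrightarrow> f z = g z"
        using eq unfolding eventually_at_topological by auto
      \<comment> \<open>Without \<open>a\<close> the set is still open, so it is a neighbourhood of
        each of its points.\<close>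
      then have "open (T - {a})" by auto
      moreover have "eventually (\<lambda>y. y \<in> T - {a}) (at a)"
        using \<open>open T\<close> \<open>a \<in> T\<close> by (auto simp: eventually_at_topological)
      ultimately show ?thesis
        using T by (auto elim!: eventually_mono simp: eventually_nhds)
    qed
    then show ?thesis
      by (rule eventually_mono) (metis higher_deriv_cong_ev)
  qed
  ultimately show ?thesis
    by (rule Lim_transform_eventually)
qed

text \<open>In Leibniz' rule only two terms survive, since \<open>z - a\<close> has vanishing second
  derivative; at \<open>z = a\<close> the first of them vanishes too.\<close>

lemma higher_deriv_linear_factor:
  assumes q: "q holomorphic_on S" and S: "open S" "a \<in> S"
  shows "(deriv ^^ Suc j) (\<lambda>z. (z - a) * q z) a = of_nat (Suc j) * (deriv ^^ j) q a"
proof -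
  \<comment> \<open>The identity is needed on all of \<open>S\<close> because the induction
    differentiates it. For \<open>n = 0\<close> the truncated \<open>n - 1\<close> is harmless: its
    coefficient is 0.\<close>
  have "(deriv ^^ n) (\<lambda>z. (z - a) * q z) z
      = (z - a) * (deriv ^^ n) q z + of_nat n * (deriv ^^ (n - 1)) q z"
    if "z \<in> S" for n z
    using that
  proof (induction n arbitrary: z)
    case (Suc n)
    have D: "((deriv ^^ m) q has_field_derivative (deriv ^^ Suc m) q z) (at z)" for m
      using holomorphic_derivI[OF holomorphic_higher_deriv[OF q S(1)] S(1) Suc.prems] by simp
    have "(deriv ^^ Suc n) (\<lambda>z. (z - a) * q z) z
        = deriv (\<lambda>z. (z - a) * (deriv ^^ n) q z + of_nat n * (deriv ^^ (n - 1)) q z) z"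
      using Suc S by (auto intro!: deriv_cong_ev eventually_nhds_in_open[THEN eventually_mono])
    also have "\<dots> = (z - a) * (deriv ^^ Suc n) q z + (deriv ^^ n) q z
        + of_nat n * (deriv ^^ Suc (n - 1)) q z"
      by (rule DERIV_imp_deriv) (rule derivative_eq_intros D refl | simp)+
    also have "\<dots> = (z - a) * (deriv ^^ Suc n) q z + of_nat (Suc n) * (deriv ^^ n) q z"
      by (cases n) (auto simp: algebra_simps)
    finally show ?case by simp
  qed simp
  from this[OF S(2), of "Suc j"] show ?thesis by simp
qed

text \<open>The difference quotient of \<open>f\<close> at \<open>a\<close> has a removable
  singularity there, with value \<open>deriv f a\<close>. This is nonzero, so by continuity the
  quotient is nonzero on an open set around \<open>a\<close>.\<close>

lemma simple_zero_factor:
  assumes f: "f holomorphic_on U" and "open U" "a \<in> U" "f a = 0" "deriv f a \<noteq> 0"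
  obtains S q where "open S" "a \<in> S" "S \<subseteq> U" "q holomorphic_on S"
    "\<And>z. z \<in> S \<Longrightarrow> f z = (z - a) * q z" "\<And>z. z \<in> S \<Longrightarrow> q z \<noteq> 0" "q a = deriv f a"
proof -
  define q where "q z = (if z = a then deriv f a else f z / (z - a))" for z
  have q: "q holomorphic_on U"
    using assms by (intro pole_theorem_open_0[OF f \<open>open U\<close>, of a]) (auto simp: q_def)
  define S where "S = U \<inter> q -` (- {0})"
  have "open S"
    unfolding S_def using q \<open>open U\<close>
    by (intro continuous_open_preimage holomorphic_on_imp_continuous_on) auto
  then show ?thesis
    using q assms by (intro that[of S q]) (auto simp: S_def q_def intro: holomorphic_on_subset)
qed

theorem proposition4p3:
  fixes D :: "'d::{finite,linorder} cvec set"
    and G H F Q :: "'d cvec \<Rightarrow> complex"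
    and p :: nat
    and c :: "'d cvec"
    and W :: "'d cvec set"
    and h :: "'d cvec \<Rightarrow> complex"
  assumes "p > 0"
    and "open D" and "connected D" and "D \<noteq> {}"
    and "holomorphic_vec_on G D" and "holomorphic_vec_on H D"
    and "hol_coprime D G H"
    and "sing_variety D H \<noteq> {}" and "0 \<in> D - sing_variety D H"
    and F: "\<And>x. x \<in> D - sing_variety D H \<Longrightarrow> F x = G x / H x ^ p"
    and "smooth_point D H c"
    and "c $ last_index * partial_deriv last_index H c \<noteq> 0"
    and "openin (top_of_set hat_space) W" and "bounded W" and "hat c \<in> W"
    and "holomorphic_vec_on h W" and "\<And>w. w \<in> W \<Longrightarrow> h w \<noteq> 0"
    and "h (hat c) = c $ last_index"
    and "\<And>w. w \<in> W \<Longrightarrow> join w (h w) \<in> sing_variety D H"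
    and "\<And>w. w \<in> W \<Longrightarrow> partial_deriv last_index H (join w (h w)) \<noteq> 0"
    and Q: "\<And>w y. w \<in> W \<Longrightarrow> join w y \<in> D - sing_variety D H \<Longrightarrow>
                Q (join w y) = H (join w y) / (y - h w)"
  shows "(\<forall>j<p. \<forall>w\<in>W.
            (u_arg p F h j w \<longlongrightarrow> u_coeff p F h j w) (at (h w)) \<and>
            (\<exists>L. ((deriv ^^ j) (\<lambda>y. G (join w y) / Q (join w y) ^ p) \<longlongrightarrow> L) (at (h w)) \<and>
                 u_coeff p F h j w = (- h w) powi (- int p + int j) * L)) \<and>
         (\<forall>j. \<forall>w\<in>W.
            ((\<lambda>y. (partial_deriv last_index ^^ j) Q (join w y)) \<longlongrightarrow>
               1 / of_nat (j + 1) * (partial_deriv last_index ^^ (j + 1)) H (join w (h w)))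
              (at (h w))) \<and>
         (\<forall>w\<in>W. u_coeff p F h 0 w =
            G (join w (h w)) / (- h w * partial_deriv last_index H (join w (h w))) ^ p)"
proof -
  have main: "(u_arg p F h j w \<longlongrightarrow> u_coeff p F h j w) (at (h w)) \<and>
       (\<exists>L. ((deriv ^^ j) (\<lambda>y. G (join w y) / Q (join w y) ^ p) \<longlongrightarrow> L) (at (h w)) \<and>
         u_coeff p F h j w = (- h w) powi (- int p + int j) * L)"
    "((\<lambda>y. (partial_deriv last_index ^^ j) Q (join w y)) \<longlongrightarrow>
       1 / of_nat (j + 1) * (partial_deriv last_index ^^ (j + 1)) H (join w (h w))) (at (h w))"
    "u_coeff p F h 0 w =
       G (join w (h w)) / (- h w * partial_deriv last_index H (join w (h w))) ^ p"
    if w: "w \<in> W" for w j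
  proof -
    define a where "a = h w"
    define U where "U = join w -` D"
    have U: "open U" "a \<in> U"
      using assms(19)[OF w] open_join_vimage[OF \<open>open D\<close>]
      by (auto simp: U_def a_def sing_variety_def)
    have g: "(\<lambda>y. G (join w y)) holomorphic_on U" and f: "(\<lambda>y. H (join w y)) holomorphic_on U"
      unfolding U_def using assms holomorphic_on_join by blast+
    have pd: "deriv (\<lambda>y. H (join w y)) a = partial_deriv last_index H (join w a)"
      using partial_deriv_funpow_join[of 1 H w a] by simp
    have "H (join w a) = 0" "deriv (\<lambda>y. H (join w y)) a \<noteq> 0" "a \<noteq> 0"
      using assms w pd by (auto simp: a_def sing_variety_def)
    then obtain S q where S: "open S" "a \<in> S" "S \<subseteq> U" and q: "q holomorphic_on S"
      and fq: "\<And>z. z \<in> S \<Longrightarrow> H (join w z) = (z - a) * q z"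
      and q0: "\<And>z. z \<in> S \<Longrightarrow> q z \<noteq> 0" and qa: "q a = deriv (\<lambda>y. H (join w y)) a"
      using simple_zero_factor[OF f U] by metis
    have ev: "eventually (\<lambda>z. z \<in> S \<and> z \<noteq> a) (at a)"
      using S by (auto simp: eventually_at_topological)
    \<comment> \<open>Both factors of \<open>H\<close> are nonzero here, so on this line the variety
      meets \<open>S\<close> only at \<open>a\<close>, and the formulas for \<open>F\<close> and
      \<open>Q\<close> apply elsewhere on \<open>S\<close>.\<close>
    have inD: "join w z \<in> D - sing_variety D H" if "z \<in> S \<and> z \<noteq> a" for z
      using that S fq q0 by (auto simp: U_def sing_variety_def)
    have evQ: "eventually (\<lambda>z. Q (join w z) = q z) (at a)"
      using ev by eventually_elim (use Q[OF w inD] fq in \<open>auto simp: a_def\<close>)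
    have evF: "eventually (\<lambda>z. (z - a) ^ p * F (join w z) = G (join w z) / q z ^ p) (at a)"
      using ev by eventually_elim (use F[OF inD] fq in \<open>auto simp: power_mult_distrib\<close>)
    have gq: "(\<lambda>z. G (join w z) / q z ^ p) holomorphic_on S"
      using q q0 holomorphic_on_subset[OF g S(3)] by (intro holomorphic_intros) auto
    \<comment> \<open>The common limit: the derivative of the holomorphic extension across
      \<open>a\<close>.\<close>
    define L where "L j = (deriv ^^ j) (\<lambda>z. G (join w z) / q z ^ p) a" for j
    \<comment> \<open>The power of \<open>- y\<close> is continuous at \<open>a\<close> even for a
      negative exponent because \<open>a\<close> \<noteq> 0.\<close>
    have lim: "(u_arg p F h j w \<longlongrightarrow> (- a) powi (- int p + int j) * L j) (at a)" for j
      unfolding u_arg_def L_def a_def[symmetric] using \<open>a \<noteq> 0\<close>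
      by (intro tendsto_intros higher_deriv_tendsto_punctured[OF gq S(1,2) evF]) simp
    \<comment> \<open>Uniqueness of limits identifies the value chosen by
      \<open>Lim\<close>.\<close>
    then have u: "u_coeff p F h j w = (- a) powi (- int p + int j) * L j" for j
      unfolding u_coeff_def a_def by (intro tendsto_Lim) auto
    have "eventually (\<lambda>z. G (join w z) / Q (join w z) ^ p = G (join w z) / q z ^ p) (at a)"
      using evQ by eventually_elim simp
    then have "((deriv ^^ j) (\<lambda>y. G (join w y) / Q (join w y) ^ p) \<longlongrightarrow> L j) (at a)"
      unfolding L_def by (rule higher_deriv_tendsto_punctured[OF gq S(1,2)])
    then show "(u_arg p F h j w \<longlongrightarrow> u_coeff p F h j w) (at (h w)) \<and>
       (\<exists>L. ((deriv ^^ j) (\<lambda>y. G (join w y) / Q (join w y) ^ p) \<longlongrightarrow> L) (at (h w)) \<and>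
         u_coeff p F h j w = (- h w) powi (- int p + int j) * L)"
      using lim u unfolding a_def by metis
    \<comment> \<open>The factorisation holds on all of \<open>S\<close>, including
      \<open>a\<close>, so the derivatives may be compared at \<open>a\<close> itself.\<close>
    have "(deriv ^^ Suc j) (\<lambda>z. H (join w z)) a = (deriv ^^ Suc j) (\<lambda>z. (z - a) * q z) a"
      using S fq by (intro higher_deriv_cong_ev eventually_nhds_in_open[THEN eventually_mono]) auto
    then have "(deriv ^^ j) q a = 1 / of_nat (j + 1) * (deriv ^^ (j + 1)) (\<lambda>z. H (join w z)) a"
      unfolding higher_deriv_linear_factor[OF q S(1,2)] by (simp del: of_nat_Suc funpow.simps)
    then show "((\<lambda>y. (partial_deriv last_index ^^ j) Q (join w y)) \<longlongrightarrow>
       1 / of_nat (j + 1) * (partial_deriv last_index ^^ (j + 1)) H (join w (h w))) (at (h w))"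
      using higher_deriv_tendsto_punctured[OF q S(1,2) evQ, of j]
      unfolding partial_deriv_funpow_join a_def by metis
    \<comment> \<open>For \<open>j = 0\<close> the limit \<open>L 0\<close> is just the value of
      \<open>G / q ^ p\<close> at \<open>a\<close>, and \<open>q a\<close> is the last partial
      derivative of \<open>H\<close>.\<close>
    show "u_coeff p F h 0 w =
        G (join w (h w)) / (- h w * partial_deriv last_index H (join w (h w))) ^ p"
      using u[of 0] unfolding a_def[symmetric] pd[symmetric] qa[symmetric] L_def
        power_mult_distrib
      by (simp add: power_int_minus field_simps)
  qed
  show ?thesis
    using main by blast
qed

end
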